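(* Let $P$ be a parallelogram polyomino underlying a Baxter slicing, placed with its bottom-left corner at $(0,0)$. Define three lattice paths: - $u$: the upper border of $P$ without its first and last steps, translated by $(0,1)$ so that it starts at $(0,2)$; - $d$: the lower border of $P$ without its first and last steps, translated by $(1,0)$ so that it starts at $(2,0)$; - $m$: the path from $(1,1)$ to the top-right corner of $P$ that follows the lower border of every horizontal block of the slicing and the left border of every vertical block. Then the map sending the Baxter slicing to $(u,m,d)$ is a size-preserving bijection between Baxter slicings and triples of non-intersecting lattice paths.
   Context: A parallelogram polyomino is an edge-connected set of unit cells of the plane forming the interior of a contour made of two lattice paths with unit steps $N=(0,1)$ and $E=(1,0)$. The two paths meet only at their common start and at their common end. If the minimal bounding rectangle has dimensions $(k,\ell)$, the size is $k+\ell-1$. A Baxter slicing of size $n$ is a parallelogram polyomino $P$ of size $n$ whose interior is divided into $n$ blocks, defined recursively: - for $n=1$, the single cell is the single block; - for $n\ge2$, one block is either the topmost row of $P$ (a horizontal block) or the rightmost column of $P$ (a vertical block), and the remaining $n-1$ blocks form a Baxter slicing of the polyomino obtained by deleting that row, respectively that column. A path of size $n$ is a sequence of $n-1$ steps, each $N$ or $E$. A triple of non-intersecting lattice paths of size $n$ is a triple $(u,m,d)$ of paths of size $n$ such that: - the three paths have the same number of $E$ steps; - $u$ starts at $(0,2)$, $m$ starts at $(1,1)$ and $d$ starts at $(2,0)$; - the embeddings of the three paths in the plane never meet. *)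

theory Defs
  imports Main
begin

datatype step = N | E

type_synonym point = "nat \<times> nat"

(* The cell (i, j) is the unit square [i, i+1] x [j, j+1]. *)
type_synonym cell = "nat \<times> nat"

(* Lattice paths are step sequences; vertices p s lists the lattice points visited by s when it is
   embedded with starting point p.  Two embedded unit-step paths that share no lattice point are
   disjoint as curves, so intersections are expressed through vertices. *)
fun vertices :: "point \<Rightarrow> step list \<Rightarrow> point list" where
  "vertices p [] = [p]"
| "vertices (x, y) (N # s) = (x, y) # vertices (x, Suc y) s"
| "vertices (x, y) (E # s) = (x, y) # vertices (Suc x, y) s"

definition endpoint :: "point \<Rightarrow> step list \<Rightarrow> point" where
  "endpoint p s = last (vertices p s)"


subsection \<open>Parallelogram polyominoes with bottom-left corner at the origin\<close>

definition contour :: "step list \<Rightarrow> step list \<Rightarrow> bool" where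
  "contour U D \<longleftrightarrow>
     endpoint (0, 0) U = endpoint (0, 0) D \<and>
     set (vertices (0, 0) U) \<inter> set (vertices (0, 0) D) = {(0, 0), endpoint (0, 0) U}"

(* In row j, the enclosed cells are those between the N step of the upper path U and the N step of
   the lower path D that cross this row. *)
definition enclosed :: "step list \<Rightarrow> step list \<Rightarrow> cell set" where
  "enclosed U D = {(i, j). \<exists>a b. a \<le> i \<and> i < b \<and>
     {(a, j), (a, Suc j)} \<subseteq> set (vertices (0, 0) U) \<and>
     {(b, j), (b, Suc j)} \<subseteq> set (vertices (0, 0) D)}"

definition borders :: "cell set \<Rightarrow> step list \<Rightarrow> step list \<Rightarrow> bool" where
  "borders P U D \<longleftrightarrow> contour U D \<and> P = enclosed U D"

definition edge_adjacent :: "cell \<Rightarrow> cell \<Rightarrow> bool" where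
  "edge_adjacent c c' \<longleftrightarrow>
     (fst c = fst c' \<and> (snd c' = Suc (snd c) \<or> snd c = Suc (snd c'))) \<or>
     (snd c = snd c' \<and> (fst c' = Suc (fst c) \<or> fst c = Suc (fst c')))"

definition edge_connected :: "cell set \<Rightarrow> bool" where
  "edge_connected P \<longleftrightarrow>
     (\<forall>c\<in>P. \<forall>c'\<in>P. (\<lambda>a b. a \<in> P \<and> b \<in> P \<and> edge_adjacent a b)\<^sup>*\<^sup>* c c')"

(* Non-emptiness rules out degenerate contours (two equal paths of length at most 1) and contours
   whose first path is not the upper one. *)
definition parallelogram_polyomino :: "cell set \<Rightarrow> bool" where
  "parallelogram_polyomino P \<longleftrightarrow> P \<noteq> {} \<and> edge_connected P \<and> (\<exists>U D. borders P U D)"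

definition upper_border :: "cell set \<Rightarrow> step list" where
  "upper_border P = (THE U. \<exists>D. borders P U D)"

definition lower_border :: "cell set \<Rightarrow> step list" where
  "lower_border P = (THE D. \<exists>U. borders P U D)"

definition width :: "cell set \<Rightarrow> nat" where
  "width P = Suc (Max (fst ` P)) - Min (fst ` P)"

definition height :: "cell set \<Rightarrow> nat" where
  "height P = Suc (Max (snd ` P)) - Min (snd ` P)"

definition poly_size :: "cell set \<Rightarrow> nat" where
  "poly_size P = width P + height P - 1"

definition top_right_corner :: "cell set \<Rightarrow> point" where
  "top_right_corner P = (Suc (Max (fst ` P)), Suc (Max (snd ` P)))"

definition top_row :: "cell set \<Rightarrow> cell set" where
  "top_row P = {c \<in> P. snd c = Max (snd ` P)}"

definition right_column :: "cell set \<Rightarrow> cell set" where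
  "right_column P = {c \<in> P. fst c = Max (fst ` P)}"


subsection \<open>Baxter slicings\<close>

(* baxter_slicing n P B H V: the set B of blocks is a Baxter slicing of size n of P, with
   horizontal blocks H and vertical blocks V.  The initial single-cell block is in neither H nor V.
   Deleting a row or column may shrink both dimensions of the bounding rectangle; this is excluded
   because what remains must be sliced with size exactly n. *)
inductive baxter_slicing ::
  "nat \<Rightarrow> cell set \<Rightarrow> cell set set \<Rightarrow> cell set set \<Rightarrow> cell set set \<Rightarrow> bool" where
  single: "parallelogram_polyomino P \<Longrightarrow> poly_size P = 1 \<Longrightarrow> baxter_slicing 1 P {P} {} {}"
| horizontal: "parallelogram_polyomino P \<Longrightarrow> poly_size P = Suc n \<Longrightarrow>
    baxter_slicing n (P - top_row P) B H V \<Longrightarrow>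
    baxter_slicing (Suc n) P (insert (top_row P) B) (insert (top_row P) H) V"
| vertical: "parallelogram_polyomino P \<Longrightarrow> poly_size P = Suc n \<Longrightarrow>
    baxter_slicing n (P - right_column P) B H V \<Longrightarrow>
    baxter_slicing (Suc n) P (insert (right_column P) B) H (insert (right_column P) V)"

definition baxter_slicings :: "nat \<Rightarrow> (cell set \<times> cell set set) set" where
  "baxter_slicings n = {(P, B). \<exists>H V. baxter_slicing n P B H V}"


subsection \<open>Triples of non-intersecting lattice paths\<close>

definition nilp_triples :: "nat \<Rightarrow> (step list \<times> step list \<times> step list) set" where
  "nilp_triples n = {(u, m, d).
     Suc (length u) = n \<and> Suc (length m) = n \<and> Suc (length d) = n \<and>
     count_list u E = count_list m E \<and> count_list m E = count_list d E \<and>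
     set (vertices (0, 2) u) \<inter> set (vertices (1, 1) m) = {} \<and>
     set (vertices (1, 1) m) \<inter> set (vertices (2, 0) d) = {} \<and>
     set (vertices (0, 2) u) \<inter> set (vertices (2, 0) d) = {}}"


subsection \<open>The map\<close>

definition lower_side :: "cell set \<Rightarrow> point list" where
  "lower_side b = map (\<lambda>x. (x, Min (snd ` b))) [Min (fst ` b)..<Suc (Suc (Max (fst ` b)))]"

definition left_side :: "cell set \<Rightarrow> point list" where
  "left_side b = map (\<lambda>y. (Min (fst ` b), y)) [Min (snd ` b)..<Suc (Suc (Max (snd ` b)))]"

(* The points listed in path join the side (listed left to right, respectively bottom to top) at
   some vertex and run along it up to its end.  The common part can reduce to the end vertex: for
   a single column cut into rows, the only path from (1, 1) to the top-right corner goes straight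
   up and meets each lower side only at its right end. *)
definition follows :: "point list \<Rightarrow> point list \<Rightarrow> bool" where
  "follows path side \<longleftrightarrow> (\<exists>k < length side. set path \<inter> set side = set (drop k side))"

definition is_middle_path :: "cell set \<Rightarrow> cell set set \<Rightarrow> step list \<Rightarrow> bool" where
  "is_middle_path P B m \<longleftrightarrow>
     endpoint (1, 1) m = top_right_corner P \<and>
     (\<exists>n H V. baxter_slicing n P B H V \<and>
        (\<forall>b\<in>H. follows (vertices (1, 1) m) (lower_side b)) \<and>
        (\<forall>b\<in>V. follows (vertices (1, 1) m) (left_side b)))"

definition middle_path :: "cell set \<Rightarrow> cell set set \<Rightarrow> step list" where
  "middle_path P B = (THE m. is_middle_path P B m)"

(* Translating a path does not change its steps: the translations by (0,1) and (1,0) only appear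
   as the starting points (0,2) and (2,0) in nilp_triples. *)
definition slicing_paths ::
  "cell set \<times> cell set set \<Rightarrow> step list \<times> step list \<times> step list" where
  "slicing_paths = (\<lambda>(P, B).
     (butlast (tl (upper_border P)), middle_path P B, butlast (tl (lower_border P))))"

end

theory Submission
  imports Defs
begin

text \<open>
  Count the north steps among the first \<open>t\<close> steps of each path. Pairwise disjointness of \<open>u\<close>, \<open>m\<close>
  and \<open>d\<close> says that these counts decrease weakly from \<open>u\<close> to \<open>m\<close> to \<open>d\<close> for every \<open>t\<close>, and the
  cells of the polyomino bounded by \<open>N u E\<close> and \<open>E d N\<close> are the \<open>(i, j)\<close> such that, for
  \<open>t = i + j\<close>, the number \<open>j\<close> lies between the counts of \<open>d\<close> and \<open>u\<close>. Deleting the top row without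
  losing a column is possible exactly when \<open>d\<close> ends with \<open>N\<close>; it removes that step of \<open>d\<close> and
  the last \<open>N\<close> of \<open>u\<close>, and \<open>m @ [N]\<close> lies weakly below \<open>u\<close> if and only if \<open>m\<close> lies weakly below
  the shortened \<open>u\<close>. Columns are symmetric. Hence the slicings of a polyomino correspond to the
  words \<open>m\<close> between \<open>u\<close> and \<open>d\<close>, where \<open>N\<close> stands for a row and \<open>E\<close> for a column. Such a word is
  the middle path: following the side of the outermost block just means passing through the
  corner next to the end of the path, so it fixes the last step.
\<close>

subsection \<open>North-step counts\<close>

definition north :: "nat \<Rightarrow> step list \<Rightarrow> nat" where
  "north t s = count_list (take t s) N"

lemma count_N_E: "count_list s N + count_list s E = length s"
proof (induction s)
  case (Cons a s)
  then show ?case by (cases a) auto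
qed simp

lemma north_0 [simp]: "north 0 s = 0"
  by (simp add: north_def)

lemma north_Suc: "north (Suc t) s = north t s + (if t < length s \<and> s ! t = N then 1 else 0)"
  by (cases "t < length s") (simp_all add: north_def take_Suc_conv_app_nth)

lemma north_all: "length s \<le> t \<Longrightarrow> north t s = count_list s N"
  by (simp add: north_def)

lemma north_length: "north (length s) s = count_list s N"
  by (simp add: north_all)

lemma north_mono: "t \<le> t' \<Longrightarrow> north t s \<le> north t' s"
  by (induction rule: dec_induct) (auto simp: north_Suc)

lemma north_le: "north t s \<le> t"
  by (induction t) (auto simp: north_Suc)

lemma north_le_count: "north t s \<le> count_list s N"
  by (cases "t \<le> length s") (use north_mono[of t "length s" s] in \<open>auto simp: north_all\<close>)

lemma north_Suc_le: "north (Suc t) s \<le> Suc (north t s)"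
  by (simp add: north_Suc)

lemma count_E_take: "t \<le> length s \<Longrightarrow> count_list (take t s) E = t - north t s"
  using count_N_E[of "take t s"] by (simp add: north_def)

lemma north_append: "north t (s @ s') = north t s + north (t - length s) s'"
  by (simp add: north_def)

lemma north_Cons: "north (Suc t) (a # s) = (if a = N then 1 else 0) + north t s"
  by (simp add: north_def)

lemma north_eqI:
  assumes "length s = length s'" "\<And>t. t \<le> length s \<Longrightarrow> north t s = north t s'"
  shows "s = s'"
proof (rule nth_equalityI)
  fix t assume t: "t < length s"
  have "(s ! t = N) = (s' ! t = N)"
    using assms(2)[of t] assms(2)[of "Suc t"] assms(1) t by (auto simp: north_Suc split: if_splits)
  then show "s ! t = s' ! t" by (metis step.exhaust)
qed (rule assms)

text \<open>A discrete intermediate value argument: counts start at 0 and rise by at most one per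
  step, so the level \<open>j\<close> is left by a north step at some time \<open>r\<close>.\<close>

lemma north_level:
  assumes "j < north t s"
  obtains r where "r < t" "r < length s" "north r s = j" "north (Suc r) s = Suc j"
  using assms
proof (induction t arbitrary: thesis)
  case (Suc t)
  show ?case
  proof (cases "j < north t s")
    case True
    then show ?thesis using Suc.IH Suc.prems by (metis less_SucI)
  next
    case False
    then have "t < length s" "north t s = j" "north (Suc t) s = Suc j"
      using Suc.prems by (auto simp: north_Suc split: if_splits)
    then show ?thesis using Suc.prems by blast
  qed
qed simp

lemma north_level_after:
  assumes "north t s \<le> j" "j < count_list s N"
  obtains r where "t \<le> r" "r < length s" "north r s = j" "north (Suc r) s = Suc j"
proof -
  have "j < north (length s) s" using assms by (simp add: north_length)
  then obtain r where r: "r < length s" "north r s = j" "north (Suc r) s = Suc j"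
    by (rule north_level)
  have "t \<le> r"
    using north_mono[of "Suc r" t s] r assms by linarith
  then show thesis using that r by blast
qed

subsection \<open>Embedded paths\<close>

text \<open>Every step raises the coordinate sum by one, so the vertex at time \<open>t\<close> lies
  on a known antidiagonal and its north count fixes it. This turns path geometry into arithmetic on
  \<open>north\<close>.\<close>

lemma vertices_eq:
  "vertices (x, y) s = map (\<lambda>t. (x + (t - north t s), y + north t s)) [0..<Suc (length s)]"
proof (induction s arbitrary: x y)
  case (Cons a s)
  have "[0..<Suc (length (a # s))] = 0 # map Suc [0..<Suc (length s)]"
    by (simp add: upt_conv_Cons map_Suc_upt del: upt_Suc)
  then show ?case
    using Cons by (cases a) (auto simp: north_Cons Suc_diff_le north_le simp del: upt_Suc)
qed (simp add: north_def)

lemma set_vertices: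
  "set (vertices (x, y) s) = (\<lambda>t. (x + (t - north t s), y + north t s)) ` {..length s}"
  by (auto simp: vertices_eq atLeast0LessThan lessThan_Suc_atMost simp del: upt_Suc)

lemma vertices_snoc: "vertices p (s @ [a]) = vertices p s @ [endpoint p (s @ [a])]"
  by (cases p) (simp add: endpoint_def vertices_eq north_append cong: map_cong)

lemma endpoint_eq: "endpoint (x, y) s = (x + count_list s E, y + count_list s N)"
  using count_N_E[of s] by (simp add: endpoint_def vertices_eq north_length)

lemma endpoint_snoc:
  "endpoint p (s @ [N]) = (fst (endpoint p s), Suc (snd (endpoint p s)))"
  "endpoint p (s @ [E]) = (Suc (fst (endpoint p s)), snd (endpoint p s))"
  by (cases p; simp add: endpoint_eq)+

text \<open>The coordinate sum of a vertex reveals when it is visited. Paths starting on one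
  antidiagonal can therefore share a vertex only at equal times, and then equal heights
  suffice.\<close>

lemma vertices_meet_iff:
  assumes "length s = length s'" "x + y = x' + y'"
  shows "v \<in> set (vertices (x, y) s) \<inter> set (vertices (x', y') s') \<longleftrightarrow>
    (\<exists>t \<le> length s. v = (x + (t - north t s), y + north t s) \<and> y + north t s = y' + north t s')"
    (is "?L \<longleftrightarrow> ?R")
proof
  assume ?L
  then obtain t t' where t: "t \<le> length s" "v = (x + (t - north t s), y + north t s)"
    and t': "t' \<le> length s'" "v = (x' + (t' - north t' s'), y' + north t' s')"
    by (auto simp: set_vertices)
  have "fst v + snd v = x + y + t" using t north_le[of t s] by simp
  moreover have "fst v + snd v = x' + y' + t'" using t' north_le[of t' s'] by simp
  ultimately have "t = t'" using assms by simp
  then show ?R using t t' by auto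
next
  assume ?R
  then obtain t where t: "t \<le> length s" "v = (x + (t - north t s), y + north t s)"
    "y + north t s = y' + north t s'" by blast
  moreover have "x + (t - north t s) = x' + (t - north t s')"
    using t(3) assms north_le[of t s] north_le[of t s'] by linarith
  ultimately show ?L using assms by (force simp: set_vertices)
qed

text \<open>The difference of heights is positive at the start and drops by at most one per step, so
  it cannot become negative without passing through 0, which is a meeting.\<close>

lemma disjoint_vertices_iff:
  assumes "length s = length s'" "x + y = x' + y'" "y < y'"
  shows "set (vertices (x, y) s) \<inter> set (vertices (x', y') s') = {} \<longleftrightarrow>
    (\<forall>t \<le> length s. y + north t s < y' + north t s')"
proof -
  have "(\<forall>t \<le> length s. y + north t s \<noteq> y' + north t s') \<longleftrightarrow>
    (\<forall>t \<le> length s. y + north t s < y' + north t s')"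
  proof
    assume *: "\<forall>t \<le> length s. y + north t s \<noteq> y' + north t s'"
    have "t \<le> length s \<Longrightarrow> y + north t s < y' + north t s'" for t
    proof (induction t)
      case (Suc t)
      then show ?case
        using * [rule_format, of "Suc t"] north_Suc_le[of t s] north_mono[of t "Suc t" s'] by simp
    qed (use assms in simp)
    then show "\<forall>t \<le> length s. y + north t s < y' + north t s'" by blast
  qed auto
  then show ?thesis using vertices_meet_iff[OF assms(1,2)] by blast
qed

section \<open>The weak order on words and the cells between two words\<close>

definition above :: "step list \<Rightarrow> step list \<Rightarrow> bool" where
  "above u d \<longleftrightarrow> length u = length d \<and> count_list u E = count_list d E \<and>
    (\<forall>t. north t d \<le> north t u)"

text \<open>The words are borders stripped of their first and last steps. On the antidiagonal
  \<open>i + j = t\<close> the cells form an interval of heights whose two ends are the north counts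
  of the words.\<close>

definition poly :: "step list \<Rightarrow> step list \<Rightarrow> cell set" where
  "poly u d = {(i, j). i + j \<le> length u \<and> north (i + j) d \<le> j \<and> j \<le> north (i + j) u}"

lemma above_lengthD: "above u d \<Longrightarrow> length u = length d"
  and above_countD: "above u d \<Longrightarrow> count_list u E = count_list d E"
    "above u d \<Longrightarrow> count_list u N = count_list d N"
  and above_northD: "above u d \<Longrightarrow> north t d \<le> north t u"
  using count_N_E[of u] count_N_E[of d] by (auto simp: above_def)

lemma aboveI:
  assumes "length u = length d" "count_list u E = count_list d E"
    "\<And>t. t < length u \<Longrightarrow> north t d \<le> north t u"
  shows "above u d"
proof -
  have "north t d \<le> north t u" for t
    using assms count_N_E[of u] count_N_E[of d] by (cases "t < length u") (auto simp: north_all)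
  then show ?thesis using assms by (simp add: above_def)
qed

lemma above_iff:
  "above u d \<longleftrightarrow> length u = length d \<and> count_list u E = count_list d E \<and>
    (\<forall>t < length u. north t d \<le> north t u)"
  using aboveI above_def by blast

lemma above_trans: "above u m \<Longrightarrow> above m d \<Longrightarrow> above u d"
  by (auto simp: above_def intro: order_trans)

lemma above_snoc: "above (u @ [a]) (d @ [a]) \<longleftrightarrow> above u d"
proof
  assume *: "above (u @ [a]) (d @ [a])"
  have "north t d \<le> north t u" if "t < length u" for t
    using above_northD[OF *, of t] above_lengthD[OF *] that by (simp add: north_append)
  then show "above u d" using above_lengthD[OF *] above_countD(1)[OF *] by (intro aboveI) auto
next
  assume *: "above u d"
  then show "above (u @ [a]) (d @ [a])"
    using above_lengthD[OF *] above_countD(1)[OF *] above_northD[OF *]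
    by (intro aboveI) (auto simp: north_append)
qed

text \<open>Neighbouring starting points lie on a common antidiagonal at heights differing by one,
  so strict separation of the embedded paths becomes a weak comparison of north counts.\<close>

lemma nilp_triples_iff:
  "(u, m, d) \<in> nilp_triples n \<longleftrightarrow> n = Suc (length m) \<and> above u m \<and> above m d"
proof (cases "length u = length m \<and> length m = length d")
  case True
  \<comment> \<open>Past the end of the words both counts equal the common total.\<close>
  have north_iff: "(\<forall>t\<le>length d. north t s' \<le> north t s) \<longleftrightarrow> (\<forall>t. north t s' \<le> north t s)"
    if "length s = length d" "length s' = length d" "count_list s E = count_list s' E" for s s'
  proof -
    have "count_list s N = count_list s' N"
      using that count_N_E[of s] count_N_E[of s'] by linarith
    then show ?thesis using that by (metis nat_le_linear north_all order_refl)
  qed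
  \<comment> \<open>The outer paths start two apart in height; the two weak comparisons compose to
    separate them.\<close>
  moreover have "\<forall>t\<le>length d. north t d < Suc (Suc (north t u))"
    if "\<forall>t\<le>length d. north t d \<le> north t m" "\<forall>t\<le>length d. north t m \<le> north t u"
    using that by (meson le_SucI le_imp_less_Suc order_trans)
  ultimately show ?thesis
    using True disjoint_vertices_iff[of m u 1 1 0 2] disjoint_vertices_iff[of d m 2 0 1 1]
      disjoint_vertices_iff[of d u 2 0 0 2] north_iff[of u m] north_iff[of m d]
    by (auto simp: nilp_triples_def above_def Int_commute[of "set (vertices (0, 2) u)"]
        Int_commute[of "set (vertices (1, 1) m)"] less_Suc_eq_le)
next
  case False
  then show ?thesis by (auto simp: nilp_triples_def above_def)
qed

section \<open>Contours and the cells they enclose\<close>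

lemma contour_iff:
  "contour U D \<longleftrightarrow> length U = length D \<and> count_list U N = count_list D N \<and>
    (\<forall>t \<le> length U. north t U = north t D \<longrightarrow> t = 0 \<or> t = length U)"
proof (cases "count_list U N = count_list D N \<and> count_list U E = count_list D E")
  case True
  then have len: "length U = length D" using count_N_E[of U] count_N_E[of D] by simp
  let ?v = "\<lambda>t. (t - north t U, north t U)"
  \<comment> \<open>Distinct times give distinct vertices, so the set of common vertices can be
    compared as a set of times.\<close>
  have v: "?v t = ?v t' \<longleftrightarrow> t = t'" for t t'
    using north_le[of t U] north_le[of t' U] by auto
  have ends: "(0, 0) = ?v 0" "endpoint (0, 0) U = ?v (length U)"
    using count_N_E[of U] by (simp_all add: endpoint_eq north_length)
  have "set (vertices (0, 0) U) \<inter> set (vertices (0, 0) D) = ?v ` {t. t \<le> length U \<and> north t U = north t D}"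
    using vertices_meet_iff[OF len, of 0 0 0 0] by (auto simp only: add_0 image_iff mem_Collect_eq)
  moreover have "{(0, 0), endpoint (0, 0) U} = ?v ` {0, length U}"
    using ends by simp
  moreover have "inj ?v" using v by (auto intro: injI)
  moreover have "endpoint (0, 0) U = endpoint (0, 0) D" using True by (simp add: endpoint_eq)
  ultimately have "contour U D \<longleftrightarrow> {t. t \<le> length U \<and> north t U = north t D} = {0, length U}"
    by (simp only: contour_def inj_image_eq_iff simp_thms)
  also have "\<dots> \<longleftrightarrow> (\<forall>t \<le> length U. north t U = north t D \<longrightarrow> t = 0 \<or> t = length U)"
    using True len by (auto simp: north_all)
  finally show ?thesis using len True by simp
next
  case False
  then show ?thesis using count_N_E[of U] count_N_E[of D] by (auto simp: contour_def endpoint_eq)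
qed

lemma mem_vertices_origin:
  "(x, y) \<in> set (vertices (0, 0) s) \<longleftrightarrow> x + y \<le> length s \<and> north (x + y) s = y"
proof
  assume "(x, y) \<in> set (vertices (0, 0) s)"
  then obtain t where "t \<le> length s" "x = t - north t s" "y = north t s"
    by (auto simp: set_vertices)
  moreover from this have "x + y = t" using north_le[of t s] by simp
  ultimately show "x + y \<le> length s \<and> north (x + y) s = y" by simp
next
  assume "x + y \<le> length s \<and> north (x + y) s = y"
  then show "(x, y) \<in> set (vertices (0, 0) s)"
    by (auto simp: set_vertices intro!: image_eqI[of _ _ "x + y"])
qed

text \<open>The top-left corner \<open>(i, Suc j)\<close> and the bottom-right corner
  \<open>(Suc i, j)\<close> of the cell share the antidiagonal \<open>Suc (i + j)\<close>. The
  condition says that \<open>U\<close> passes weakly above the former and \<open>D\<close> weakly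
  below the latter.\<close>

lemma enclosed_iff:
  assumes "length U = length D" "count_list U N = count_list D N"
  shows "(i, j) \<in> enclosed U D \<longleftrightarrow> north (Suc (i + j)) D \<le> j \<and> j < north (Suc (i + j)) U"
proof
  assume "(i, j) \<in> enclosed U D"
  then obtain a b where ab: "a \<le> i" "i < b" "north (Suc (a + j)) U = Suc j" "north (b + j) D = j"
    by (auto simp: enclosed_def mem_vertices_origin)
  have "north (Suc (i + j)) D \<le> north (b + j) D" "north (Suc (a + j)) U \<le> north (Suc (i + j)) U"
    using ab by (intro north_mono; simp)+
  then show "north (Suc (i + j)) D \<le> j \<and> j < north (Suc (i + j)) U" using ab by simp
next
  assume *: "north (Suc (i + j)) D \<le> j \<and> j < north (Suc (i + j)) U"
  \<comment> \<open>\<open>r\<close> is the time at which \<open>U\<close> crosses row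
    \<open>j\<close>, and \<open>q\<close> below is the time at which \<open>D\<close> does; the
    crossings happen in columns \<open>r - j\<close> and \<open>q - j\<close>.\<close>
  then obtain r where r: "r < Suc (i + j)" "r < length U" "north r U = j" "north (Suc r) U = Suc j"
    using north_level by blast
  have "j < count_list D N" using * assms(2) north_le_count[of "Suc (i + j)" U] by simp
  then obtain q where q: "Suc (i + j) \<le> q" "q < length D" "north q D = j" "north (Suc q) D = Suc j"
    using * north_level_after by blast
  have "j \<le> r" using r north_le[of r U] by simp
  then have "r - j \<le> i" "i < q - j" "{(r - j, j), (r - j, Suc j)} \<subseteq> set (vertices (0, 0) U)"
    "{(q - j, j), (q - j, Suc j)} \<subseteq> set (vertices (0, 0) D)"
    using r q by (auto simp: mem_vertices_origin)
  then show "(i, j) \<in> enclosed U D" unfolding enclosed_def by blast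
qed

text \<open>The opening steps \<open>N\<close> and \<open>E\<close> shift time by one and give the
  upper path one extra north step, which turns the strict bound into a weak one. Beyond the end of
  \<open>u\<close> the closing \<open>N\<close> of the lower border leaves no room for a
  cell.\<close>

lemma enclosed_eq_poly:
  assumes "above u d"
  shows "enclosed (N # u @ [E]) (E # d @ [N]) = poly u d"
proof -
  have "north (i + j) (d @ [N]) \<le> j \<and> j < Suc (north (i + j) (u @ [E])) \<longleftrightarrow>
    i + j \<le> length u \<and> north (i + j) d \<le> j \<and> j \<le> north (i + j) u" for i j
    using above_lengthD[OF assms] above_countD[OF assms]
    by (cases "i + j \<le> length u")
      (auto simp: north_append north_all north_Cons not_le less_Suc_eq_le dest!: less_imp_Suc_add)
  then show ?thesis
    using above_lengthD[OF assms] above_countD[OF assms]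
    by (auto simp: enclosed_iff north_Cons poly_def)
qed

lemma contour_above: "above u d \<Longrightarrow> contour (N # u @ [E]) (E # d @ [N])"
  unfolding contour_iff
proof (intro conjI allI impI)
  fix t
  assume "above u d" "t \<le> length (N # u @ [E])"
    and eq: "north t (N # u @ [E]) = north t (E # d @ [N])"
  then show "t = 0 \<or> t = length (N # u @ [E])"
    using above_lengthD[of u d] above_northD[of u d "t - 1"]
    by (cases t) (auto simp: north_Cons north_append le_Suc_eq)
qed (auto simp: above_lengthD above_countD)

text \<open>An enclosed cell yields one time \<open>r\<close> at which \<open>U\<close> is strictly
  above \<open>D\<close>. The sign of the difference cannot change without a meeting, so
  \<open>U\<close> stays strictly above at all interior times, which forces the first and last
  steps.\<close>

lemma contour_enclosed_nonempty:
  assumes "contour U D" "enclosed U D \<noteq> {}"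
  obtains u d where "U = N # u @ [E]" "D = E # d @ [N]" "above u d"
proof -
  from assms(1) have len: "length U = length D" and cnt: "count_list U N = count_list D N"
    and meet: "\<And>t. t \<le> length U \<Longrightarrow> north t U = north t D \<Longrightarrow> t = 0 \<or> t = length U"
    unfolding contour_iff by blast+
  obtain r where r: "north r D < north r U"
    using assms(2) len cnt by (auto simp: enclosed_iff) (metis le_less_trans)
  have r0: "0 < r" "r < length U"
    using r len cnt by (auto intro: gr0I) (metis less_irrefl north_all not_le)
  have up: "r \<le> t \<Longrightarrow> t < length U \<Longrightarrow> north t D < north t U" for t
  proof (induction t rule: dec_induct)
    case (step t)
    then show ?case
      using meet[of "Suc t"] north_Suc_le[of t D] north_mono[of t "Suc t" U] by force
  qed (rule r)
  have down: "t \<le> r \<Longrightarrow> 0 < t \<Longrightarrow> north t D < north t U" for t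
  proof (induction t rule: inc_induct)
    case (step t)
    then show ?case
      using meet[of t] north_Suc_le[of t U] north_mono[of t "Suc t" D] r0 by force
  qed (rule r)
  have all: "north t D < north t U" if "0 < t" "t < length U" for t
    using up down that by (meson nat_le_linear)
  obtain a U' where U': "U = a # U'" using r0 by (cases U) auto
  obtain u b where u: "U' = u @ [b]" using r0 U' by (cases U' rule: rev_cases) auto
  obtain a' D' where D': "D = a' # D'" using r0 len by (cases D) auto
  obtain d b' where d: "D' = d @ [b']" using r0 len D' by (cases D' rule: rev_cases) auto
  note eqs = U' u D' d
  have ld: "length u = length d" using len eqs by simp
  have "a = N" "a' = E" using all[of 1] r0 eqs
    by (auto simp: north_Suc split: if_splits) (metis step.exhaust)
  have *: "north t d \<le> north t u" if "t \<le> length u" for t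
    using all[of "Suc t"] that eqs ld \<open>a = N\<close> \<open>a' = E\<close> by (simp add: north_Cons north_append)
  \<comment> \<open>Before the last step \<open>U\<close> leads by at least one, yet the totals
    agree: only \<open>D\<close> can gain in that step.\<close>
  have "b = E" "b' = N"
    using *[of "length u"] cnt ld eqs \<open>a = N\<close> \<open>a' = E\<close>
    by (auto simp: north_all split: if_splits) (metis step.exhaust)
  then show thesis
    using that[of u d] * ld eqs \<open>a = N\<close> \<open>a' = E\<close> cnt count_N_E[of u] count_N_E[of d]
    by (simp add: aboveI)
qed

subsection \<open>Polyominoes between two paths\<close>

text \<open>Each antidiagonal up to the length meets the region in a nonempty interval and later
  ones miss it. The length is thus visible in the region, and the ends of the intervals give back
  all north counts.\<close>

lemma poly_inject:
  assumes "poly u d = poly u' d'" "above u d" "above u' d'"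
  shows "u = u' \<and> d = d'"
proof -
  have diag: "{j. j \<le> t \<and> (t - j, j) \<in> poly v e} =
      (if t \<le> length v then {north t e..north t v} else {})" for v e t
    using north_le[of t v] by (auto simp: poly_def)
  have ne: "{north t e..north t v} \<noteq> {}" if "above v e" for t v e
    using above_northD[OF that] by simp
  have eq: "(if t \<le> length u then {north t d..north t u} else {}) =
      (if t \<le> length u' then {north t d'..north t u'} else {})" for t
    using diag[of t u d] diag[of t u' d'] assms(1) by simp
  have "length u \<le> length u'"
    using eq[of "length u"] ne[OF assms(2), of "length u"] by (auto split: if_splits)
  moreover have "length u' \<le> length u"
    using eq[of "length u'"] ne[OF assms(3), of "length u'"] by (auto split: if_splits)
  ultimately have len: "length u = length u'" by simp
  have "north t d = north t d' \<and> north t u = north t u'" if "t \<le> length u" for t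
    using eq[of t] that len above_northD[OF assms(2), of t] above_northD[OF assms(3), of t]
    by (auto simp: Icc_eq_Icc)
  then show ?thesis
    using len above_lengthD[OF assms(2)] above_lengthD[OF assms(3)]
    by (auto intro!: north_eqI)
qed

lemma poly_corners:
  assumes "above u d"
  shows "(0, 0) \<in> poly u d" "(count_list u E, count_list u N) \<in> poly u d"
  using above_countD[OF assms] above_lengthD[OF assms] count_N_E[of u]
  by (auto simp: poly_def north_all add.commute)

lemma poly_bounds:
  assumes "above u d" "(i, j) \<in> poly u d"
  shows "i \<le> count_list u E" "j \<le> count_list u N"
proof -
  \<comment> \<open>The cell lies weakly above \<open>d\<close>, so its column is bounded by the
    number of \<open>E\<close> steps that \<open>d\<close> has made by time
    \<open>i + j\<close>.\<close>
  have "i \<le> (i + j) - north (i + j) d" using assms by (auto simp: poly_def)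
  also have "\<dots> = count_list (take (i + j) d) E"
    using assms above_lengthD[OF assms(1)] by (auto simp: poly_def count_E_take)
  also have "\<dots> \<le> count_list d E"
    using append_take_drop_id[of "i + j" d] by (metis count_list_append le_add1)
  finally show "i \<le> count_list u E" using above_countD[OF assms(1)] by simp
  show "j \<le> count_list u N" using assms north_le_count[of "i + j" u] by (auto simp: poly_def)
qed

lemma finite_poly: "finite (poly u d)"
  by (rule finite_subset[of _ "{..length u} \<times> {..length u}"]) (auto simp: poly_def)

lemma poly_extremes:
  assumes "above u d"
  shows "Max (fst ` poly u d) = count_list u E" "Min (fst ` poly u d) = 0"
    "Max (snd ` poly u d) = count_list u N" "Min (snd ` poly u d) = 0"
  using poly_corners[OF assms] poly_bounds[OF assms]
  by (auto intro!: Max_eqI Min_eqI finite_imageI finite_poly intro: rev_image_eqI)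

lemma poly_size_poly: "above u d \<Longrightarrow> poly_size (poly u d) = Suc (length u)"
  using count_N_E[of u] by (simp add: poly_size_def width_def height_def poly_extremes)

text \<open>Every cell other than the origin has its left or its lower neighbour in the region, so
  descending along antidiagonals connects it to the origin.\<close>

lemma edge_connected_poly:
  assumes "above u d"
  shows "edge_connected (poly u d)"
proof -
  define R where "R = (\<lambda>a b. a \<in> poly u d \<and> b \<in> poly u d \<and> edge_adjacent a b)"
  have "symp R" by (auto simp: R_def edge_adjacent_def intro: sympI)
  then have sym: "R\<^sup>*\<^sup>* a b \<Longrightarrow> R\<^sup>*\<^sup>* b a" for a b
    by (meson sympD symp_rtranclp)
  have "(i, j) \<in> poly u d \<Longrightarrow> i + j = t \<Longrightarrow> R\<^sup>*\<^sup>* (0, 0) (i, j)" for t i j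
  proof (induction t arbitrary: i j)
    case (Suc t)
    have d: "north t d \<le> j" "j \<le> Suc (north t u)" "Suc t \<le> length u"
      using Suc.prems north_mono[of t "Suc t" d] north_Suc_le[of t u] by (auto simp: poly_def)
    have d': "north t d \<le> north t u" "north t u \<le> t" "north (Suc t) d \<le> Suc (north t d)"
      using above_northD[OF assms] by (simp_all add: north_le north_Suc_le)
    obtain c where c: "c \<in> poly u d" "fst c + snd c = t" "edge_adjacent c (i, j)"
    \<comment> \<open>If the left neighbour would lie above \<open>u\<close>, then
      \<open>j = Suc (north t u)\<close>, and the lower neighbour is the topmost cell of the
      previous antidiagonal.\<close>
    proof (cases "j \<le> north t u")
      case True
      then have "(i - 1, j) \<in> poly u d" "(i - 1) + j = t" "edge_adjacent (i - 1, j) (i, j)"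
        using Suc.prems d d' by (auto simp: poly_def edge_adjacent_def)
      then show thesis using that[of "(i - 1, j)"] by simp
    next
      case False
      then have "(i, j - 1) \<in> poly u d" "i + (j - 1) = t" "edge_adjacent (i, j - 1) (i, j)"
        using Suc.prems d d' by (auto simp: poly_def edge_adjacent_def)
      then show thesis using that[of "(i, j - 1)"] by simp
    qed
    then have "R\<^sup>*\<^sup>* (0, 0) c" using Suc.IH[of "fst c" "snd c"] by simp
    moreover have "R c (i, j)" using c Suc.prems by (simp add: R_def)
    ultimately show ?case by simp
  qed simp
  then have "c \<in> poly u d \<Longrightarrow> R\<^sup>*\<^sup>* (0, 0) c" for c by (cases c) simp
  then show ?thesis
    unfolding edge_connected_def R_def[symmetric] using sym by (meson rtranclp_trans)
qed

text \<open>Uniqueness comes from \<open>poly_inject\<close>; it makes the definite descriptions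
  behind \<open>upper_border\<close> and \<open>lower_border\<close> meaningful.\<close>

lemma borders_poly_iff:
  assumes "above u d"
  shows "borders (poly u d) U D \<longleftrightarrow> U = N # u @ [E] \<and> D = E # d @ [N]"
proof
  assume b: "borders (poly u d) U D"
  then have "contour U D" "enclosed U D \<noteq> {}" and P: "poly u d = enclosed U D"
    using poly_corners[OF assms] by (auto simp: borders_def)
  then obtain u' d' where *: "U = N # u' @ [E]" "D = E # d' @ [N]" "above u' d'"
    using contour_enclosed_nonempty by blast
  then show "U = N # u @ [E] \<and> D = E # d @ [N]"
    using poly_inject[of u d u' d'] P assms by (simp add: enclosed_eq_poly)
next
  assume "U = N # u @ [E] \<and> D = E # d @ [N]"
  then show "borders (poly u d) U D"
    using assms by (simp add: borders_def contour_above enclosed_eq_poly)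
qed

lemma upper_border_poly: "above u d \<Longrightarrow> upper_border (poly u d) = N # u @ [E]"
  and lower_border_poly: "above u d \<Longrightarrow> lower_border (poly u d) = E # d @ [N]"
  by (simp_all add: upper_border_def lower_border_def borders_poly_iff)

lemma parallelogram_polyomino_iff:
  "parallelogram_polyomino P \<longleftrightarrow> (\<exists>u d. above u d \<and> P = poly u d)"
proof
  assume "parallelogram_polyomino P"
  then obtain U D where "contour U D" "enclosed U D \<noteq> {}" "P = enclosed U D"
    by (auto simp: parallelogram_polyomino_def borders_def)
  then show "\<exists>u d. above u d \<and> P = poly u d"
    by (elim contour_enclosed_nonempty) (auto simp: enclosed_eq_poly)
next
  assume "\<exists>u d. above u d \<and> P = poly u d"
  then obtain u d where ud: "above u d" "P = poly u d" by blast
  then have "borders P (N # u @ [E]) (E # d @ [N])" by (simp add: borders_poly_iff)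
  moreover have "P \<noteq> {}" using ud poly_corners(1) by blast
  ultimately show "parallelogram_polyomino P"
    using ud edge_connected_poly by (auto simp: parallelogram_polyomino_def)
qed

lemma parallelogram_polyominoE:
  assumes "parallelogram_polyomino P"
  obtains u d where "above u d" "P = poly u d"
  using assms parallelogram_polyomino_iff by blast

subsection \<open>Removing the top row or the right column\<close>

text \<open>Reflection in the main diagonal. It exchanges rows with columns and upper with lower
  borders, so facts about columns follow from facts about rows.\<close>

fun flip :: "step list \<Rightarrow> step list" where
  "flip [] = []"
| "flip (N # s) = E # flip s"
| "flip (E # s) = N # flip s"

lemma length_flip [simp]: "length (flip s) = length s"
  by (induction s rule: flip.induct) auto

lemma flip_flip [simp]: "flip (flip s) = s"
  by (induction s rule: flip.induct) auto

lemma flip_append [simp]: "flip (s @ s') = flip s @ flip s'"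
  by (induction s rule: flip.induct) auto

lemma count_flip [simp]: "count_list (flip s) N = count_list s E" "count_list (flip s) E = count_list s N"
  by (induction s rule: flip.induct) auto

lemma take_flip: "take t (flip s) = flip (take t s)"
proof (induction s arbitrary: t)
  case (Cons a s)
  then show ?case by (cases a; cases t) auto
qed simp

lemma north_flip: "t \<le> length s \<Longrightarrow> north t (flip s) = t - north t s"
  by (simp add: north_def[of t "flip s"] take_flip count_E_take)

lemma above_flip: "above (flip d) (flip u) \<longleftrightarrow> above u d"
proof -
  have "above (flip e) (flip v)" if "above v e" for v e
    using that above_countD[OF that] above_lengthD[OF that] above_northD[OF that]
    by (intro aboveI) (simp_all add: north_flip diff_le_mono2)
  then show ?thesis by (metis flip_flip)
qed

lemma poly_flip:
  assumes "above u d"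
  shows "poly (flip d) (flip u) = prod.swap ` poly u d"
proof -
  have "(i, j) \<in> poly (flip d) (flip u) \<longleftrightarrow> (j, i) \<in> poly u d" for i j
    using above_lengthD[OF assms] north_le[of "i + j" u] north_le[of "i + j" d]
    by (auto simp: poly_def north_flip add.commute[of j i])
  then show ?thesis by (force simp: image_iff)
qed

text \<open>\<open>s'\<close> omits the last \<open>N\<close> of \<open>s\<close>. Only
  \<open>E\<close> steps follow that \<open>N\<close>, so counts before it are unchanged and later
  ones are capped at one less than the total.\<close>

lemma drop_north:
  assumes "N \<in> set s"
  obtains s' where "length s = Suc (length s')" "count_list s' E = count_list s E"
    "\<And>t. t < length s \<Longrightarrow> north t s' = min (north t s) (count_list s N - 1)"
proof -
  obtain a b where s: "s = a @ N # b" "N \<notin> set b" using split_list_last[OF assms] by blast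
  have b: "north r b = 0" for r
    using north_le_count[of r b] s(2) by (simp add: count_list_0_iff)
  have "north t (a @ b) = min (north t s) (count_list s N - 1)" for t
  proof (cases "t \<le> length a")
    case True
    then show ?thesis using s b north_le_count[of t a] by (auto simp: north_append count_list_0_iff)
  next
    case False
    then obtain r where "t = length a + Suc r"
      by (metis add_Suc_right less_imp_Suc_add not_le)
    then show ?thesis using s b by (simp add: north_append north_Cons north_all count_list_0_iff)
  qed
  then show thesis using that[of "a @ b"] s by simp
qed

lemma top_row_poly: "above u d \<Longrightarrow> top_row (poly u d) = {c \<in> poly u d. snd c = count_list u N}"
  by (simp add: top_row_def poly_extremes)

text \<open>\<open>u'\<close> is \<open>u\<close> without its last \<open>N\<close>, whose counts
  are those of \<open>u\<close> capped one below the top row. A word \<open>m\<close> that reaches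
  the common total only with a further \<open>N\<close> never exceeds this cap, hence the
  equivalence.\<close>

lemma remove_top_row:
  assumes "above u (d @ [N])"
  obtains u' where "poly u (d @ [N]) - top_row (poly u (d @ [N])) = poly u' d" "above u' d"
    "\<And>m. above u (m @ [N]) \<longleftrightarrow> above u' m"
proof -
  note len = above_lengthD[OF assms] and cnt = above_countD[OF assms]
  have "N \<in> set u" using cnt(2) count_list_0_iff[of u N] by auto
  then obtain u' where u': "length u = Suc (length u')" "count_list u' E = count_list u E"
    "\<And>t. t < length u \<Longrightarrow> north t u' = min (north t u) (count_list u N - 1)"
    using drop_north by blast
  have iff: "above u (m @ [N]) \<longleftrightarrow> above u' m" for m
  proof (cases "length u' = length m \<and> count_list u E = count_list m E")
    case True
    have "north t m \<le> north t u \<longleftrightarrow> north t m \<le> north t u'" if "t < length u" for t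
      using True u' that north_le_count[of t m] count_N_E[of u] count_N_E[of m] by auto
    then have "above u (m @ [N]) \<longleftrightarrow> (\<forall>t < length u. north t m \<le> north t u')"
      using True u' by (auto simp: above_iff north_append)
    also have "\<dots> \<longleftrightarrow> above u' m"
      using True u'(1,2) by (auto simp: above_northD intro: aboveI)
    finally show ?thesis .
  next
    case False
    then show ?thesis using u' by (auto simp: above_iff)
  qed
  have ab: "above u' d" using iff assms by blast
  have "poly u (d @ [N]) - top_row (poly u (d @ [N])) = poly u' d"
    (is "?L = ?R")
  proof -
    \<comment> \<open>Before the last antidiagonal the removal cuts the value
      \<open>count_list u N\<close> off each interval; the last antidiagonal holds only the corner
      cell, which lies in the top row.\<close>
    have "(i, j) \<in> ?L \<longleftrightarrow> (i, j) \<in> ?R" for i j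
    proof (cases "i + j < length u")
      case True
      then have "(i, j) \<in> ?R \<longleftrightarrow> north (i + j) d \<le> j \<and> j \<le> north (i + j) u \<and> j \<le> count_list u N - 1"
        using u' by (auto simp: poly_def)
      moreover have "(i, j) \<in> ?L \<longleftrightarrow> north (i + j) d \<le> j \<and> j \<le> north (i + j) u \<and> j \<noteq> count_list u N"
        unfolding top_row_poly[OF assms] using True len by (auto simp: poly_def north_append)
      ultimately show ?thesis using cnt north_le_count[of "i + j" u] by auto
    next
      case False
      have "(i, j) \<notin> ?L"
        unfolding top_row_poly[OF assms] using False len cnt by (auto simp: poly_def north_all)
      moreover have "(i, j) \<notin> ?R" using False u' by (auto simp: poly_def)
      ultimately show ?thesis by blast
    qed
    then show ?thesis by auto
  qed
  then show thesis using that ab iff by blast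
qed

lemma right_column_swap: "right_column P = prod.swap ` top_row (prod.swap ` P)"
  by (force simp: right_column_def top_row_def image_image)

lemma remove_right_column:
  assumes "above (u @ [E]) d"
  obtains d' where "poly (u @ [E]) d - right_column (poly (u @ [E]) d) = poly u d'" "above u d'"
    "\<And>m. above (m @ [E]) d \<longleftrightarrow> above m d'"
proof -
  have "above (flip d) (flip u @ [N])" using assms above_flip[of d "u @ [E]"] by simp
  then obtain d' where d': "poly (flip d) (flip u @ [N]) - top_row (poly (flip d) (flip u @ [N])) = poly d' (flip u)"
    "above d' (flip u)" "\<And>m. above (flip d) (m @ [N]) \<longleftrightarrow> above d' m"
    by (rule remove_top_row) blast
  have sw: "poly (flip d) (flip u @ [N]) = prod.swap ` poly (u @ [E]) d"
    using poly_flip[OF assms] by simp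
  have "poly (u @ [E]) d - right_column (poly (u @ [E]) d) =
      prod.swap ` (prod.swap ` poly (u @ [E]) d - top_row (prod.swap ` poly (u @ [E]) d))"
    by (simp add: right_column_swap image_set_diff image_image)
  also have "\<dots> = prod.swap ` poly d' (flip u)" using d'(1) sw by simp
  also have "\<dots> = poly u (flip d')" using poly_flip[OF d'(2)] by simp
  finally have "poly (u @ [E]) d - right_column (poly (u @ [E]) d) = poly u (flip d')" .
  moreover have "above u (flip d')" using d'(2) above_flip[of "flip d'" u] by simp
  moreover have "above (m @ [E]) d \<longleftrightarrow> above m (flip d')" for m
    using d'(3)[of "flip m"] above_flip[of d "m @ [E]"] above_flip[of "flip d'" m] by simp
  ultimately show thesis using that by blast
qed

lemma polyomino_finite: "parallelogram_polyomino P \<Longrightarrow> finite P"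
  and polyomino_corner: "parallelogram_polyomino P \<Longrightarrow> (Max (fst ` P), Max (snd ` P)) \<in> P"
  by (auto simp: parallelogram_polyomino_iff finite_poly poly_corners poly_extremes)

lemma polyomino_size:
  assumes "parallelogram_polyomino P"
  shows "poly_size P = Suc (Max (fst ` P) + Max (snd ` P))"
proof -
  obtain u d where "above u d" "P = poly u d" using assms by (rule parallelogram_polyominoE)
  then show ?thesis using count_N_E[of u] by (simp add: poly_size_poly poly_extremes)
qed

subsection \<open>Slicings as words\<close>

text \<open>Removing the top row lowers the height and cannot enlarge the width. As the size falls
  by exactly one, the height falls by one and the width is kept.\<close>

lemma max_remove_top_row:
  assumes "parallelogram_polyomino P" "parallelogram_polyomino (P - top_row P)"
    "poly_size P = Suc (poly_size (P - top_row P))"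
  shows "Max (fst ` (P - top_row P)) = Max (fst ` P)" "Suc (Max (snd ` (P - top_row P))) = Max (snd ` P)"
proof -
  let ?P' = "P - top_row P"
  have c: "(Max (fst ` ?P'), Max (snd ` ?P')) \<in> ?P'" by (rule polyomino_corner[OF assms(2)])
  then have "Max (fst ` ?P') \<in> fst ` P" "Max (snd ` ?P') \<in> snd ` P" by (auto intro: rev_image_eqI)
  then have "Max (fst ` ?P') \<le> Max (fst ` P)" "Max (snd ` ?P') \<le> Max (snd ` P)"
    using polyomino_finite[OF assms(1)] by auto
  moreover have "Max (snd ` ?P') \<noteq> Max (snd ` P)" using c by (auto simp: top_row_def)
  ultimately show "Max (fst ` ?P') = Max (fst ` P)" "Suc (Max (snd ` ?P')) = Max (snd ` P)"
    using assms(3) polyomino_size[OF assms(1)] polyomino_size[OF assms(2)] by linarith+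
qed

lemma max_remove_right_column:
  assumes "parallelogram_polyomino P" "parallelogram_polyomino (P - right_column P)"
    "poly_size P = Suc (poly_size (P - right_column P))"
  shows "Suc (Max (fst ` (P - right_column P))) = Max (fst ` P)" "Max (snd ` (P - right_column P)) = Max (snd ` P)"
proof -
  let ?P' = "P - right_column P"
  have c: "(Max (fst ` ?P'), Max (snd ` ?P')) \<in> ?P'" by (rule polyomino_corner[OF assms(2)])
  then have "Max (fst ` ?P') \<in> fst ` P" "Max (snd ` ?P') \<in> snd ` P" by (auto intro: rev_image_eqI)
  then have "Max (fst ` ?P') \<le> Max (fst ` P)" "Max (snd ` ?P') \<le> Max (snd ` P)"
    using polyomino_finite[OF assms(1)] by auto
  moreover have "Max (fst ` ?P') \<noteq> Max (fst ` P)" using c by (auto simp: right_column_def)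
  ultimately show "Suc (Max (fst ` ?P')) = Max (fst ` P)" "Max (snd ` ?P') = Max (snd ` P)"
    using assms(3) polyomino_size[OF assms(1)] polyomino_size[OF assms(2)] by linarith+
qed

text \<open>Slicings carrying the word of their cuts, with the outermost block recorded by the last
  letter. The word makes induction and the comparison with \<open>m\<close> possible.\<close>

inductive slices ::
  "step list \<Rightarrow> cell set \<Rightarrow> cell set set \<Rightarrow> cell set set \<Rightarrow> cell set set \<Rightarrow> bool" where
  single: "parallelogram_polyomino P \<Longrightarrow> poly_size P = 1 \<Longrightarrow> slices [] P {P} {} {}"
| row: "parallelogram_polyomino P \<Longrightarrow> poly_size P = Suc (Suc (length m)) \<Longrightarrow>
    slices m (P - top_row P) B H V \<Longrightarrow>
    slices (m @ [N]) P (insert (top_row P) B) (insert (top_row P) H) V"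
| column: "parallelogram_polyomino P \<Longrightarrow> poly_size P = Suc (Suc (length m)) \<Longrightarrow>
    slices m (P - right_column P) B H V \<Longrightarrow>
    slices (m @ [E]) P (insert (right_column P) B) H (insert (right_column P) V)"

lemma baxter_slicing_iff_slices:
  "baxter_slicing n P B H V \<longleftrightarrow> (\<exists>m. n = Suc (length m) \<and> slices m P B H V)"
proof
  assume "baxter_slicing n P B H V"
  then show "\<exists>m. n = Suc (length m) \<and> slices m P B H V"
  proof (induction rule: baxter_slicing.induct)
    case (single P)
    then show ?case by (intro exI[of _ "[]"]) (simp add: slices.single)
  next
    case (horizontal P n B H V)
    then obtain m where "n = Suc (length m)" "slices m (P - top_row P) B H V" by blast
    then show ?case using horizontal by (intro exI[of _ "m @ [N]"]) (simp add: slices.row)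
  next
    case (vertical P n B H V)
    then obtain m where "n = Suc (length m)" "slices m (P - right_column P) B H V" by blast
    then show ?case using vertical by (intro exI[of _ "m @ [E]"]) (simp add: slices.column)
  qed
next
  have "slices m P B H V \<Longrightarrow> baxter_slicing (Suc (length m)) P B H V" for m
    by (induction rule: slices.induct)
      (auto intro: baxter_slicing.intros simp: baxter_slicing.single[unfolded One_nat_def])
  then show "\<exists>m. n = Suc (length m) \<and> slices m P B H V \<Longrightarrow> baxter_slicing n P B H V"
    by blast
qed

lemma slices_polyomino: "slices m P B H V \<Longrightarrow> parallelogram_polyomino P"
  and slices_size: "slices m P B H V \<Longrightarrow> poly_size P = Suc (length m)"
  by (auto elim: slices.cases)

lemma slices_row_max:
  assumes "parallelogram_polyomino P" "poly_size P = Suc (Suc (length m))"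
    "slices m (P - top_row P) B H V"
  shows "Max (fst ` (P - top_row P)) = Max (fst ` P)" "Suc (Max (snd ` (P - top_row P))) = Max (snd ` P)"
  using max_remove_top_row[OF assms(1) slices_polyomino[OF assms(3)]] assms(2) slices_size[OF assms(3)]
  by simp_all

lemma slices_column_max:
  assumes "parallelogram_polyomino P" "poly_size P = Suc (Suc (length m))"
    "slices m (P - right_column P) B H V"
  shows "Suc (Max (fst ` (P - right_column P))) = Max (fst ` P)" "Max (snd ` (P - right_column P)) = Max (snd ` P)"
  using max_remove_right_column[OF assms(1) slices_polyomino[OF assms(3)]] assms(2) slices_size[OF assms(3)]
  by simp_all

lemma corner_in_top_row: "parallelogram_polyomino P \<Longrightarrow> (Max (fst ` P), Max (snd ` P)) \<in> top_row P"
  and corner_in_right_column: "parallelogram_polyomino P \<Longrightarrow> (Max (fst ` P), Max (snd ` P)) \<in> right_column P"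
  by (auto simp: top_row_def right_column_def polyomino_corner)

lemma slices_blocks:
  assumes "slices m P B H V"
  shows "\<Union> B = P" "{} \<notin> B" "H \<subseteq> B" "V \<subseteq> B"
proof -
  from assms have "\<Union> B = P \<and> {} \<notin> B \<and> H \<subseteq> B \<and> V \<subseteq> B"
  proof (induction rule: slices.induct)
    case (single P)
    then show ?case using polyomino_corner by auto
  next
    case (row P m B H V)
    moreover have "top_row P \<subseteq> P" by (auto simp: top_row_def)
    ultimately show ?case using corner_in_top_row[of P] by auto
  next
    case (column P m B H V)
    moreover have "right_column P \<subseteq> P" by (auto simp: right_column_def)
    ultimately show ?case using corner_in_right_column[of P] by auto
  qed
  then show "\<Union> B = P" "{} \<notin> B" "H \<subseteq> B" "V \<subseteq> B" by blast+
qed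

text \<open>The top row and the right column share the corner cell, and blocks of the remainder
  avoid it. Equal block sets would make the row equal to the column, but removing the row keeps the
  width, so a cell of the last column survives.\<close>

lemma row_blocks_neq_column_blocks:
  assumes "parallelogram_polyomino P" "poly_size P = Suc (Suc (length m))" "slices m (P - top_row P) B H V"
    and "slices m' (P - right_column P) B' H' V'"
  shows "insert (top_row P) B \<noteq> insert (right_column P) B'"
proof
  assume "insert (top_row P) B = insert (right_column P) B'"
  moreover have "right_column P \<notin> B"
    using slices_blocks(1)[OF assms(3)] corner_in_right_column[OF assms(1)] corner_in_top_row[OF assms(1)]
    by blast
  ultimately have eq: "right_column P = top_row P" by blast
  let ?P' = "P - top_row P"
  have "(Max (fst ` ?P'), Max (snd ` ?P')) \<in> ?P'"
    using slices_polyomino[OF assms(3)] by (rule polyomino_corner)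
  then have "(Max (fst ` P), Max (snd ` ?P')) \<in> P - right_column P"
    using slices_row_max[OF assms(1-3)] eq by simp
  then show False by (simp add: right_column_def)
qed

text \<open>The disjunction lets one induction prove both directions: the word determines the
  blocks, and the blocks determine the word. Either way the types of the blocks are determined as
  well.\<close>

lemma slices_unique:
  assumes "slices m P B H V" "slices m' P B' H' V'" "m = m' \<or> B = B'"
  shows "m = m' \<and> B = B' \<and> H = H' \<and> V = V'"
  using assms
proof (induction arbitrary: m' B' H' V' rule: slices.induct)
  case (single P)
  then show ?case using slices_size[OF single.prems(1)]
    by (auto elim: slices.cases)
next
  case (row P m B H V)
  from row.prems(1) show ?case
  proof cases
    case (row n C I)
    \<comment> \<open>Both block sets cover only what is left of \<open>P\<close>, so the outermost
      block can be cancelled from an equality of the two insertions.\<close>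
    have "top_row P \<notin> B" "top_row P \<notin> C"
      using slices_blocks[OF \<open>slices m _ B H V\<close>] slices_blocks[OF \<open>slices n _ C _ _\<close>]
        corner_in_top_row[OF \<open>parallelogram_polyomino P\<close>] by blast+
    then have "m = n \<or> B = C" using row.prems(2) row(1-4) by (auto simp: insert_ident)
    then have "m = n \<and> B = C \<and> H = I \<and> V = V'" by (rule row.IH[OF \<open>slices n _ C _ _\<close>])
    then show ?thesis using row(1-3) by blast
  next
    case (column n C W)
    have "insert (top_row P) B \<noteq> B'"
      unfolding column(2) by (rule row_blocks_neq_column_blocks[OF row.hyps column(6)])
    then show ?thesis using row.prems(2) column(1) by blast
  qed (use row.hyps in simp)
next
  case (column P m B H V)
  from column.prems(1) show ?case
  proof cases
    case (column n C W)
    have "right_column P \<notin> B" "right_column P \<notin> C"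
      using slices_blocks[OF \<open>slices m _ B H V\<close>] slices_blocks[OF \<open>slices n _ C _ _\<close>]
        corner_in_right_column[OF \<open>parallelogram_polyomino P\<close>] by blast+
    then have "m = n \<or> B = C" using column.prems(2) column(1-4) by (auto simp: insert_ident)
    then have "m = n \<and> B = C \<and> H = H' \<and> V = W" by (rule column.IH[OF \<open>slices n _ C _ _\<close>])
    then show ?thesis using column(1-3) by blast
  next
    case (row n C I)
    have "B' \<noteq> insert (right_column P) B"
      unfolding row(2) by (rule row_blocks_neq_column_blocks[OF row(4-6) column.hyps(3)])
    then show ?thesis using column.prems(2) row(1) by blast
  qed (use column.hyps in simp)
qed

section \<open>Words of slicings are the words between the two borders\<close>

lemma last_step_N:
  assumes "length s = Suc n" "north n s < count_list s N"
  obtains s' where "s = s' @ [N]"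
proof -
  obtain s' a where s: "s = s' @ [a]" using assms(1) by (cases s rule: rev_cases) auto
  then show thesis using assms that by (cases a) (auto simp: north_all north_append)
qed

lemma last_step_E:
  assumes "length s = Suc n" "count_list s N \<le> north n s"
  obtains s' where "s = s' @ [E]"
proof -
  obtain s' a where s: "s = s' @ [a]" using assms(1) by (cases s rule: rev_cases) auto
  then show thesis using assms that by (cases a) (auto simp: north_all north_append)
qed

lemma slices_paths:
  assumes "slices m P B H V"
  obtains u d where "P = poly u d" "above u m" "above m d"
proof -
  from assms have "\<exists>u d. P = poly u d \<and> above u m \<and> above m d"
  proof (induction rule: slices.induct)
    case (single P)
    then obtain u d where "above u d" "P = poly u d" by (auto elim: parallelogram_polyominoE)
    moreover from this have "u = []" "d = []"
      using single by (auto simp: poly_size_poly above_def)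
    ultimately show ?case by blast
  next
    case (row P m B H V)
    then obtain u d where ud: "above u d" "P = poly u d" by (auto elim: parallelogram_polyominoE)
    have len: "length u = Suc (length m)" "length d = Suc (length m)"
      using row ud by (auto simp: poly_size_poly above_def)
    obtain u' d' where ud': "P - top_row P = poly u' d'" "above u' m" "above m d'"
      using row.IH by blast
    \<comment> \<open>This is the top-right cell of the remainder, which has kept the full
      width.\<close>
    have "(Max (fst ` P), Max (snd ` P) - 1) \<in> P"
      using polyomino_corner[OF slices_polyomino[OF row.hyps(3)]] slices_row_max(1)[OF row.hyps]
        slices_row_max(2)[OF row.hyps, symmetric] by simp
    moreover have "Max (snd ` P) > 0" using slices_row_max(2)[OF row.hyps] by linarith
    ultimately have mem: "(count_list u E, count_list u N - 1) \<in> poly u d" and pos: "count_list u N > 0"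
      unfolding ud(2) poly_extremes[OF ud(1)] by blast+
    have "count_list u E + (count_list u N - 1) = length m" using pos len count_N_E[of u] by simp
    \<comment> \<open>That cell lies on antidiagonal \<open>length m\<close>, weakly above
      \<open>d\<close> and below the top row, so \<open>d\<close> still owes a north step and must
      end with \<open>N\<close>.\<close>
    then have "north (length m) d < count_list d N"
      using mem pos above_countD[OF ud(1)] by (auto simp: poly_def)
    then obtain d0 where d0: "d = d0 @ [N]" using last_step_N[OF len(2)] by blast
    obtain u0 where u0: "P - top_row P = poly u0 d0" "above u0 d0" "\<And>m. above u (m @ [N]) \<longleftrightarrow> above u0 m"
      using remove_top_row[of u d0] ud d0 by blast
    \<comment> \<open>The borders obtained by shortening \<open>u\<close> and \<open>d\<close> and
      those from the induction hypothesis bound the same region.\<close>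
    have eq: "u0 = u'" "d0 = d'"
      using poly_inject[of u0 d0 u' d'] u0 ud' above_trans[OF ud'(2,3)] by simp_all
    then have "above u (m @ [N])" "above (m @ [N]) d"
      using u0(3) ud'(2,3) eq by (simp_all add: d0 above_snoc)
    then show ?case using ud by blast
  next
    case (column P m B H V)
    then obtain u d where ud: "above u d" "P = poly u d" by (auto elim: parallelogram_polyominoE)
    have len: "length u = Suc (length m)" "length d = Suc (length m)"
      using column ud by (auto simp: poly_size_poly above_def)
    obtain u' d' where ud': "P - right_column P = poly u' d'" "above u' m" "above m d'"
      using column.IH by blast
    have "(Max (fst ` P) - 1, Max (snd ` P)) \<in> P"
      using polyomino_corner[OF slices_polyomino[OF column.hyps(3)]] slices_column_max(2)[OF column.hyps]
        slices_column_max(1)[OF column.hyps, symmetric] by simp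
    moreover have "Max (fst ` P) > 0" using slices_column_max(1)[OF column.hyps] by linarith
    ultimately have mem: "(count_list u E - 1, count_list u N) \<in> poly u d" and pos: "count_list u E > 0"
      unfolding ud(2) poly_extremes[OF ud(1)] by blast+
    have "count_list u E - 1 + count_list u N = length m" using pos len count_N_E[of u] by simp
    \<comment> \<open>The cell left of the corner is weakly below \<open>u\<close>, so
      \<open>u\<close> has made all its north steps by then and ends with \<open>E\<close>.\<close>
    then have "count_list u N \<le> north (length m) u"
      using mem by (auto simp: poly_def)
    then obtain v where v: "u = v @ [E]" using last_step_E[OF len(1)] by blast
    obtain e where e: "P - right_column P = poly v e" "above v e" "\<And>m. above (m @ [E]) d \<longleftrightarrow> above m e"
      using remove_right_column[of v d] ud v by blast
    have eq: "v = u'" "e = d'"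
      using poly_inject[of v e u' d'] e ud' above_trans[OF ud'(2,3)] by simp_all
    then have "above u (m @ [E])" "above (m @ [E]) d"
      using e(3) ud'(2,3) eq by (simp_all add: v above_snoc)
    then show ?case using ud by blast
  qed
  then show thesis using that by blast
qed

lemma slices_exists:
  assumes "above u m" "above m d"
  obtains B H V where "slices m (poly u d) B H V"
proof -
  from assms have "\<exists>B H V. slices m (poly u d) B H V"
  proof (induction m arbitrary: u d rule: rev_induct)
    case Nil
    then have "u = []" "d = []" by (auto simp: above_def)
    then have "above u d" by (simp add: above_def)
    then show ?case
      using slices.single[of "poly u d"] \<open>u = []\<close> poly_size_poly[of u d]
      by (auto simp: parallelogram_polyomino_iff)
  next
    case (snoc a m)
    have ud: "above u d" using snoc.prems by (rule above_trans)
    have len: "length u = Suc (length m)" "length d = Suc (length m)"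
      using snoc.prems by (auto simp: above_def)
    have P: "parallelogram_polyomino (poly u d)" "poly_size (poly u d) = Suc (Suc (length m))"
      using ud len by (auto simp: parallelogram_polyomino_iff poly_size_poly)
    show ?case
    proof (cases a)
      case N
      \<comment> \<open>\<open>d\<close> is weakly below \<open>m @ [N]\<close> just before the
        final step, so it cannot have completed its north steps earlier.\<close>
      have "north (length m) d < count_list d N"
        using above_northD[OF snoc.prems(2), of "length m"] above_countD[OF snoc.prems(2)] N
        by (simp add: north_append north_all)
      then obtain d0 where d0: "d = d0 @ [N]" using last_step_N[OF len(2)] by blast
      obtain u0 where u0: "poly u d - top_row (poly u d) = poly u0 d0" "above u0 d0"
        "\<And>m. above u (m @ [N]) \<longleftrightarrow> above u0 m"
        using remove_top_row[of u d0] ud d0 by blast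
      have "above u0 m" using u0 snoc.prems N by simp
      moreover have "above m d0"
        using snoc.prems(2) N d0 by (simp add: above_snoc)
      ultimately obtain B H V where "slices m (poly u0 d0) B H V" using snoc.IH by blast
      then show ?thesis using slices.row[OF P, of B H V] u0 N by auto
    next
      case E
      have "count_list u N \<le> north (length m) u"
        using above_northD[OF snoc.prems(1), of "length m"] above_countD[OF snoc.prems(1)] E
        by (simp add: north_append north_all)
      then obtain v where v: "u = v @ [E]" using last_step_E[OF len(1)] by blast
      obtain e where e: "poly u d - right_column (poly u d) = poly v e" "above v e"
        "\<And>m. above (m @ [E]) d \<longleftrightarrow> above m e"
        using remove_right_column[of v d] ud v by blast
      have "above m e" using e snoc.prems E by simp
      moreover have "above v m"
        using snoc.prems(1) E v by (simp add: above_snoc)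
      ultimately obtain B H V where "slices m (poly v e) B H V" using snoc.IH by blast
      then show ?thesis using slices.column[OF P, of B H V] e E by auto
    qed
  qed
  then show thesis using that by blast
qed

subsection \<open>The middle path\<close>

lemma vertices_le_endpoint:
  assumes "v \<in> set (vertices p s)"
  shows "fst v \<le> fst (endpoint p s)" "snd v \<le> snd (endpoint p s)"
proof -
  have "fst v \<le> fst (endpoint p s) \<and> snd v \<le> snd (endpoint p s)"
    using assms
  proof (induction s rule: rev_induct)
    case Nil
    then show ?case by (cases p) (simp add: endpoint_def)
  next
    case (snoc a s)
    then show ?case by (cases a) (auto simp: vertices_snoc endpoint_snoc)
  qed
  then show "fst v \<le> fst (endpoint p s)" "snd v \<le> snd (endpoint p s)" by simp_all
qed

text \<open>A monotone path enters the row of its endpoint once and then stays there. The resulting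
  interval ending at the endpoint supplies the tail of a side required by
  \<open>follows\<close>.\<close>

lemma vertices_last_row:
  assumes "endpoint p s = (x, y)"
  obtains c where "c \<le> x" "\<And>x'. (x', y) \<in> set (vertices p s) \<longleftrightarrow> c \<le> x' \<and> x' \<le> x"
  using assms
proof (induction s arbitrary: x y thesis rule: rev_induct)
  case Nil
  then show ?case by (cases p) (force simp: endpoint_def)
next
  case (snoc a s)
  obtain x0 y0 where e: "endpoint p s = (x0, y0)" by (cases "endpoint p s")
  show ?case
  proof (cases a)
    case N
    then have xy: "x = x0" "y = Suc y0" using e snoc.prems(2) by (simp_all add: endpoint_snoc)
    have "(x', y) \<notin> set (vertices p s)" for x'
      using vertices_le_endpoint(2)[of "(x', y)" p s] e xy by auto
    then show ?thesis
      using snoc.prems(2) by (intro snoc.prems(1)[of x]) (auto simp: vertices_snoc)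
  next
    case E
    then have xy: "x = Suc x0" "y = y0" using e snoc.prems(2) by (simp_all add: endpoint_snoc)
    obtain c where c: "c \<le> x0" "\<And>x'. (x', y0) \<in> set (vertices p s) \<longleftrightarrow> c \<le> x' \<and> x' \<le> x0"
      using snoc.IH[OF _ e] by blast
    have "(x', y) \<in> set (vertices p (s @ [a])) \<longleftrightarrow> c \<le> x' \<and> x' \<le> x" for x'
    proof -
      have "(x', y) \<in> set (vertices p (s @ [a])) \<longleftrightarrow> x' = x \<or> c \<le> x' \<and> x' \<le> x0"
        unfolding vertices_snoc snoc.prems(2) using c(2)[of x'] xy by simp
      also have "\<dots> \<longleftrightarrow> c \<le> x' \<and> x' \<le> x" using c(1) xy by linarith
      finally show ?thesis .
    qed
    then show ?thesis using c(1) xy by (intro snoc.prems(1)[of c]) simp_all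
  qed
qed

lemma vertices_last_column:
  assumes "endpoint p s = (x, y)"
  obtains c where "c \<le> y" "\<And>y'. (x, y') \<in> set (vertices p s) \<longleftrightarrow> c \<le> y' \<and> y' \<le> y"
  using assms
proof (induction s arbitrary: x y thesis rule: rev_induct)
  case Nil
  then show ?case by (cases p) (force simp: endpoint_def)
next
  case (snoc a s)
  obtain x0 y0 where e: "endpoint p s = (x0, y0)" by (cases "endpoint p s")
  show ?case
  proof (cases a)
    case E
    then have xy: "x = Suc x0" "y = y0" using e snoc.prems(2) by (simp_all add: endpoint_snoc)
    have "(x, y') \<notin> set (vertices p s)" for y'
      using vertices_le_endpoint(1)[of "(x, y')" p s] e xy by auto
    then show ?thesis
      using snoc.prems(2) by (intro snoc.prems(1)[of y]) (auto simp: vertices_snoc)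
  next
    case N
    then have xy: "x = x0" "y = Suc y0" using e snoc.prems(2) by (simp_all add: endpoint_snoc)
    obtain c where c: "c \<le> y0" "\<And>y'. (x0, y') \<in> set (vertices p s) \<longleftrightarrow> c \<le> y' \<and> y' \<le> y0"
      using snoc.IH[OF _ e] by blast
    have "(x, y') \<in> set (vertices p (s @ [a])) \<longleftrightarrow> c \<le> y' \<and> y' \<le> y" for y'
    proof -
      have "(x, y') \<in> set (vertices p (s @ [a])) \<longleftrightarrow> y' = y \<or> c \<le> y' \<and> y' \<le> y0"
        unfolding vertices_snoc snoc.prems(2) using c(2)[of y'] xy by simp
      also have "\<dots> \<longleftrightarrow> c \<le> y' \<and> y' \<le> y" using c(1) xy by linarith
      finally show ?thesis .
    qed
    then show ?thesis using c(1) xy by (intro snoc.prems(1)[of c]) simp_all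
  qed
qed

text \<open>The bound on \<open>k\<close> makes the common tail nonempty, so it contains the end of
  the side.\<close>

lemma follows_last: "follows path side \<Longrightarrow> last side \<in> set path"
  by (metis IntD1 drop_eq_Nil follows_def last_drop last_in_set not_le)

lemma follows_snoc: "v \<notin> set side \<Longrightarrow> follows (path @ [v]) side \<longleftrightarrow> follows path side"
  by (simp add: follows_def Int_insert_left)

lemma follows_row:
  assumes "endpoint p s = (x, y)" "a \<le> x"
  shows "follows (vertices p (s @ [N])) (map (\<lambda>x. (x, y)) [a..<Suc x])"
proof -
  obtain c where c: "c \<le> x" "\<And>x'. (x', y) \<in> set (vertices p s) \<longleftrightarrow> c \<le> x' \<and> x' \<le> x"
    using vertices_last_row[OF assms(1)] by blast
  \<comment> \<open>By truncated subtraction \<open>a + (c - a)\<close> is the maximum of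
    \<open>a\<close> and \<open>c\<close>, written in the form that dropping \<open>c - a\<close>
    elements from the list produces.\<close>
  have "set (vertices p s) \<inter> (\<lambda>x. (x, y)) ` {a..<Suc x} = (\<lambda>x. (x, y)) ` {a + (c - a)..<Suc x}"
    (is "?L = ?R")
  proof -
    have "w \<in> ?L \<longleftrightarrow> w \<in> ?R" for w
    proof -
      have "w \<in> ?L \<longleftrightarrow> (\<exists>x'. w = (x', y) \<and> a \<le> x' \<and> c \<le> x' \<and> x' \<le> x)"
        using c(2) by (auto simp only: Int_iff image_iff Bex_def atLeastLessThan_iff less_Suc_eq_le)
      also have "\<dots> \<longleftrightarrow> (\<exists>x'. w = (x', y) \<and> a + (c - a) \<le> x' \<and> x' \<le> x)"
      proof -
        have "a \<le> x' \<and> c \<le> x' \<and> x' \<le> x \<longleftrightarrow> a + (c - a) \<le> x' \<and> x' \<le> x" for x' by arith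
        then show ?thesis by (simp only:)
      qed
      also have "\<dots> \<longleftrightarrow> w \<in> ?R"
        by (auto simp only: image_iff Bex_def atLeastLessThan_iff less_Suc_eq_le)
      finally show ?thesis .
    qed
    then show ?thesis by blast
  qed
  then have "follows (vertices p s) (map (\<lambda>x. (x, y)) [a..<Suc x])"
    unfolding follows_def using assms(2) c(1)
    by (intro exI[of _ "c - a"]) (simp add: drop_map del: upt_Suc)
  moreover have "endpoint p (s @ [N]) = (x, Suc y)"
    using assms(1) by (simp add: endpoint_snoc)
  moreover have "(x, Suc y) \<notin> set (map (\<lambda>x. (x, y)) [a..<Suc x])" by (auto simp del: upt_Suc)
  ultimately show ?thesis by (simp only: vertices_snoc follows_snoc simp_thms)
qed

lemma follows_column:
  assumes "endpoint p s = (x, y)" "a \<le> y"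
  shows "follows (vertices p (s @ [E])) (map (\<lambda>y. (x, y)) [a..<Suc y])"
proof -
  obtain c where c: "c \<le> y" "\<And>y'. (x, y') \<in> set (vertices p s) \<longleftrightarrow> c \<le> y' \<and> y' \<le> y"
    using vertices_last_column[OF assms(1)] by blast
  have "set (vertices p s) \<inter> (\<lambda>y. (x, y)) ` {a..<Suc y} = (\<lambda>y. (x, y)) ` {a + (c - a)..<Suc y}"
    (is "?L = ?R")
  proof -
    have "w \<in> ?L \<longleftrightarrow> w \<in> ?R" for w
    proof -
      have "w \<in> ?L \<longleftrightarrow> (\<exists>y'. w = (x, y') \<and> a \<le> y' \<and> c \<le> y' \<and> y' \<le> y)"
        using c(2) by (auto simp only: Int_iff image_iff Bex_def atLeastLessThan_iff less_Suc_eq_le)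
      also have "\<dots> \<longleftrightarrow> (\<exists>y'. w = (x, y') \<and> a + (c - a) \<le> y' \<and> y' \<le> y)"
      proof -
        have "a \<le> y' \<and> c \<le> y' \<and> y' \<le> y \<longleftrightarrow> a + (c - a) \<le> y' \<and> y' \<le> y" for y' by arith
        then show ?thesis by (simp only:)
      qed
      also have "\<dots> \<longleftrightarrow> w \<in> ?R"
        by (auto simp only: image_iff Bex_def atLeastLessThan_iff less_Suc_eq_le)
      finally show ?thesis .
    qed
    then show ?thesis by blast
  qed
  then have "follows (vertices p s) (map (\<lambda>y. (x, y)) [a..<Suc y])"
    unfolding follows_def using assms(2) c(1)
    by (intro exI[of _ "c - a"]) (simp add: drop_map del: upt_Suc)
  moreover have "endpoint p (s @ [E]) = (Suc x, y)"
    using assms(1) by (simp add: endpoint_snoc)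
  moreover have "(Suc x, y) \<notin> set (map (\<lambda>y. (x, y)) [a..<Suc y])" by (auto simp del: upt_Suc)
  ultimately show ?thesis by (simp only: vertices_snoc follows_snoc simp_thms)
qed

text \<open>With a last step \<open>E\<close> the earlier vertices would all lie strictly left of
  column \<open>x\<close>, so \<open>(x, y)\<close> could not have been visited.\<close>

lemma last_step_N_vertices:
  assumes "endpoint p s = (x, Suc y)" "(x, y) \<in> set (vertices p s)"
  obtains s' where "s = s' @ [N]" "endpoint p s' = (x, y)"
proof (cases s rule: rev_cases)
  case Nil
  then show thesis using assms by (cases p) (simp add: endpoint_def)
next
  case (snoc s' a)
  then show thesis
    using assms vertices_le_endpoint(1)[of "(x, y)" p s'] that
    by (cases a; cases "endpoint p s'") (auto simp: vertices_snoc endpoint_snoc)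
qed

lemma last_step_E_vertices:
  assumes "endpoint p s = (Suc x, y)" "(x, y) \<in> set (vertices p s)"
  obtains s' where "s = s' @ [E]" "endpoint p s' = (x, y)"
proof (cases s rule: rev_cases)
  case Nil
  then show thesis using assms by (cases p) (simp add: endpoint_def)
next
  case (snoc s' a)
  then show thesis
    using assms vertices_le_endpoint(2)[of "(x, y)" p s'] that
    by (cases a; cases "endpoint p s'") (auto simp: vertices_snoc endpoint_snoc)
qed

lemma lower_side_top_row:
  assumes "parallelogram_polyomino P"
  obtains a where "a \<le> Suc (Max (fst ` P))"
    "lower_side (top_row P) = map (\<lambda>x. (x, Max (snd ` P))) [a..<Suc (Suc (Max (fst ` P)))]"
proof -
  note c = corner_in_top_row[OF assms]
  have sub: "top_row P \<subseteq> P" by (auto simp: top_row_def)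
  have fin: "finite (fst ` top_row P)" "finite (fst ` P)"
    using polyomino_finite[OF assms] sub finite_subset by blast+
  have "snd ` top_row P = {Max (snd ` P)}"
    using c by (force simp: top_row_def)
  moreover have mem: "Max (fst ` P) \<in> fst ` top_row P" using c by (simp add: rev_image_eqI)
  moreover have "Max (fst ` top_row P) = Max (fst ` P)"
    using fin image_mono[OF sub, of fst] by (intro Max_eqI mem Max_ge) auto
  moreover have "Min (fst ` top_row P) \<le> Max (fst ` P)"
    using fin(1) mem by (rule Min_le)
  ultimately show thesis
    by (intro that[of "Min (fst ` top_row P)"]) (simp_all add: lower_side_def del: upt_Suc)
qed

lemma left_side_right_column:
  assumes "parallelogram_polyomino P"
  obtains a where "a \<le> Suc (Max (snd ` P))"
    "left_side (right_column P) = map (\<lambda>y. (Max (fst ` P), y)) [a..<Suc (Suc (Max (snd ` P)))]"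
proof -
  note c = corner_in_right_column[OF assms]
  have sub: "right_column P \<subseteq> P" by (auto simp: right_column_def)
  have fin: "finite (snd ` right_column P)" "finite (snd ` P)"
    using polyomino_finite[OF assms] sub finite_subset by blast+
  have "fst ` right_column P = {Max (fst ` P)}"
    using c by (force simp: right_column_def)
  moreover have mem: "Max (snd ` P) \<in> snd ` right_column P" using c by (simp add: rev_image_eqI)
  moreover have "Max (snd ` right_column P) = Max (snd ` P)"
    using fin image_mono[OF sub, of snd] by (intro Max_eqI mem Max_ge) auto
  moreover have "Min (snd ` right_column P) \<le> Max (snd ` P)"
    using fin(1) mem by (rule Min_le)
  ultimately show thesis
    by (intro that[of "Min (snd ` right_column P)"]) (simp_all add: left_side_def del: upt_Suc)
qed

text \<open>Lower sides stay below the top edge of the polyomino and left sides stay left of its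
  right edge. A vertex added beyond the remainder therefore avoids the sides of all earlier
  blocks.\<close>

lemma slices_sides:
  assumes "slices m P B H V"
  shows "b \<in> H \<Longrightarrow> v \<in> set (lower_side b) \<Longrightarrow> snd v \<le> Max (snd ` P)"
    and "b \<in> V \<Longrightarrow> v \<in> set (left_side b) \<Longrightarrow> fst v \<le> Max (fst ` P)"
proof -
  have fin: "finite P" using slices_polyomino[OF assms] by (rule polyomino_finite)
  have *: "Min (snd ` b) \<le> Max (snd ` P)" "Min (fst ` b) \<le> Max (fst ` P)" if "b \<in> B" for b
  proof -
    have b: "b \<noteq> {}" "b \<subseteq> P" using that slices_blocks(1,2)[OF assms] by blast+
    then have "finite b" using fin finite_subset by blast
    then have "Min (snd ` b) \<in> snd ` b" "Min (fst ` b) \<in> fst ` b"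
      using b by (auto intro!: Min_in)
    then show "Min (snd ` b) \<le> Max (snd ` P)" "Min (fst ` b) \<le> Max (fst ` P)"
      using b(2) fin by (auto intro!: Max_ge)
  qed
  show "b \<in> H \<Longrightarrow> v \<in> set (lower_side b) \<Longrightarrow> snd v \<le> Max (snd ` P)"
    using slices_blocks(3)[OF assms] * by (auto simp: lower_side_def)
  show "b \<in> V \<Longrightarrow> v \<in> set (left_side b) \<Longrightarrow> fst v \<le> Max (fst ` P)"
    using slices_blocks(4)[OF assms] * by (auto simp: left_side_def)
qed

text \<open>The condition on a middle path with the two kinds of blocks fixed, which allows
  induction on the slicing.\<close>

definition fits :: "cell set \<Rightarrow> cell set set \<Rightarrow> cell set set \<Rightarrow> step list \<Rightarrow> bool" where
  "fits P H V m \<longleftrightarrow> endpoint (1, 1) m = top_right_corner P \<and>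
     (\<forall>b\<in>H. follows (vertices (1, 1) m) (lower_side b)) \<and>
     (\<forall>b\<in>V. follows (vertices (1, 1) m) (left_side b))"

text \<open>Existence and uniqueness in one induction: the outermost side forces the last step, and
  the final vertex lies off all earlier sides, so their conditions transfer to the shortened path
  and back.\<close>

lemma fits_iff:
  assumes "slices m P B H V"
  shows "fits P H V s \<longleftrightarrow> s = m"
  using assms
proof (induction arbitrary: s rule: slices.induct)
  case (single P)
  then have "top_right_corner P = (1, 1)"
    using polyomino_size[of P] by (simp add: top_right_corner_def)
  then show ?case using count_N_E[of s] by (auto simp: fits_def endpoint_eq)
next
  case (row P m B H V)
  let ?P' = "P - top_row P"
  let ?x = "Suc (Max (fst ` P))" and ?y = "Max (snd ` P)"
  have corner: "top_right_corner P = (?x, Suc ?y)" "top_right_corner ?P' = (?x, ?y)"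
    using slices_row_max[OF row.hyps] by (simp_all add: top_right_corner_def)
  obtain a where a: "a \<le> ?x" "lower_side (top_row P) = map (\<lambda>x. (x, ?y)) [a..<Suc ?x]"
    using row.hyps(1) by (rule lower_side_top_row)
  have old: "follows (vertices (1, 1) (r @ [N])) (lower_side b) \<longleftrightarrow> follows (vertices (1, 1) r) (lower_side b)"
      if "endpoint (1, 1) r = (?x, ?y)" "b \<in> H" for r b
  proof -
    have "(?x, Suc ?y) \<notin> set (lower_side b)"
      using slices_sides(1)[OF row.hyps(3) that(2), of "(?x, Suc ?y)"] slices_row_max(2)[OF row.hyps] by auto
    then show ?thesis using that(1) by (simp add: vertices_snoc endpoint_snoc follows_snoc)
  qed
  have old': "follows (vertices (1, 1) (r @ [N])) (left_side b) \<longleftrightarrow> follows (vertices (1, 1) r) (left_side b)"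
      if "endpoint (1, 1) r = (?x, ?y)" "b \<in> V" for r b
  proof -
    have "(?x, Suc ?y) \<notin> set (left_side b)"
      using slices_sides(2)[OF row.hyps(3) that(2), of "(?x, Suc ?y)"] slices_row_max(1)[OF row.hyps] by auto
    then show ?thesis using that(1) by (simp add: vertices_snoc endpoint_snoc follows_snoc)
  qed
  show ?case
  proof
    assume fits: "fits P (insert (top_row P) H) V s"
    then have "last (lower_side (top_row P)) \<in> set (vertices (1, 1) s)"
      by (auto simp: fits_def intro: follows_last)
    \<comment> \<open>The right end of the lower side is the vertex directly below the corner, so
      the path must arrive there by \<open>N\<close>.\<close>
    then have "(?x, ?y) \<in> set (vertices (1, 1) s)" using a by (simp add: last_map)
    moreover have "endpoint (1, 1) s = (?x, Suc ?y)" using fits corner by (simp add: fits_def)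
    ultimately obtain r where r: "s = r @ [N]" "endpoint (1, 1) r = (?x, ?y)"
      using last_step_N_vertices by blast
    then have "fits ?P' H V r" using fits old old' by (simp add: fits_def corner)
    then show "s = m @ [N]" using row.IH r by simp
  next
    assume s: "s = m @ [N]"
    have fits: "fits ?P' H V m" using row.IH by simp
    then have e: "endpoint (1, 1) m = (?x, ?y)" by (simp add: fits_def corner)
    then have "follows (vertices (1, 1) s) (lower_side (top_row P))"
      unfolding s a(2) using a(1) by (rule follows_row)
    then show "fits P (insert (top_row P) H) V s"
      using fits old[OF e] old'[OF e] e by (simp add: fits_def corner endpoint_snoc s)
  qed
next
  case (column P m B H V)
  let ?P' = "P - right_column P"
  let ?x = "Max (fst ` P)" and ?y = "Suc (Max (snd ` P))"
  have corner: "top_right_corner P = (Suc ?x, ?y)" "top_right_corner ?P' = (?x, ?y)"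
    using slices_column_max[OF column.hyps] by (simp_all add: top_right_corner_def)
  obtain a where a: "a \<le> ?y" "left_side (right_column P) = map (\<lambda>y. (?x, y)) [a..<Suc ?y]"
    using column.hyps(1) by (rule left_side_right_column)
  have old: "follows (vertices (1, 1) (r @ [E])) (lower_side b) \<longleftrightarrow> follows (vertices (1, 1) r) (lower_side b)"
      if "endpoint (1, 1) r = (?x, ?y)" "b \<in> H" for r b
  proof -
    have "(Suc ?x, ?y) \<notin> set (lower_side b)"
      using slices_sides(1)[OF column.hyps(3) that(2), of "(Suc ?x, ?y)"] slices_column_max(2)[OF column.hyps] by auto
    then show ?thesis using that(1) by (simp add: vertices_snoc endpoint_snoc follows_snoc)
  qed
  have old': "follows (vertices (1, 1) (r @ [E])) (left_side b) \<longleftrightarrow> follows (vertices (1, 1) r) (left_side b)"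
      if "endpoint (1, 1) r = (?x, ?y)" "b \<in> V" for r b
  proof -
    have "(Suc ?x, ?y) \<notin> set (left_side b)"
      using slices_sides(2)[OF column.hyps(3) that(2), of "(Suc ?x, ?y)"] slices_column_max(1)[OF column.hyps] by auto
    then show ?thesis using that(1) by (simp add: vertices_snoc endpoint_snoc follows_snoc)
  qed
  show ?case
  proof
    assume fits: "fits P H (insert (right_column P) V) s"
    then have "last (left_side (right_column P)) \<in> set (vertices (1, 1) s)"
      by (auto simp: fits_def intro: follows_last)
    then have "(?x, ?y) \<in> set (vertices (1, 1) s)" using a by (simp add: last_map)
    moreover have "endpoint (1, 1) s = (Suc ?x, ?y)" using fits corner by (simp add: fits_def)
    ultimately obtain r where r: "s = r @ [E]" "endpoint (1, 1) r = (?x, ?y)"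
      using last_step_E_vertices by blast
    then have "fits ?P' H V r" using fits old old' by (simp add: fits_def corner)
    then show "s = m @ [E]" using column.IH r by simp
  next
    assume s: "s = m @ [E]"
    have fits: "fits ?P' H V m" using column.IH by simp
    then have e: "endpoint (1, 1) m = (?x, ?y)" by (simp add: fits_def corner)
    then have "follows (vertices (1, 1) s) (left_side (right_column P))"
      unfolding s a(2) using a(1) by (rule follows_column)
    then show "fits P H (insert (right_column P) V) s"
      using fits old[OF e] old'[OF e] e by (simp add: fits_def corner endpoint_snoc s)
  qed
qed

section \<open>The bijection\<close>

lemma is_middle_path_iff:
  assumes "slices m P B H V"
  shows "is_middle_path P B s \<longleftrightarrow> s = m"
proof -
  have "is_middle_path P B s \<longleftrightarrow> (\<exists>n H V. baxter_slicing n P B H V \<and> fits P H V s)"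
    by (auto simp: is_middle_path_def fits_def)
  also have "\<dots> \<longleftrightarrow> (\<exists>m' H' V'. slices m' P B H' V' \<and> s = m')"
    unfolding baxter_slicing_iff_slices using fits_iff by blast
  \<comment> \<open>The block set alone determines the word, so every admissible choice of block
    types leads to the same path.\<close>
  also have "\<dots> \<longleftrightarrow> s = m" using assms slices_unique by blast
  finally show ?thesis .
qed

lemma slicing_paths_eq:
  assumes "slices m (poly u d) B H V" "above u m" "above m d"
  shows "slicing_paths (poly u d, B) = (u, m, d)"
proof -
  have "middle_path (poly u d) B = m"
    unfolding middle_path_def using is_middle_path_iff[OF assms(1)] by (intro the_equality) simp_all
  then show ?thesis
    using above_trans[OF assms(2,3)]
    by (simp add: slicing_paths_def upper_border_poly lower_border_poly)
qed

lemma baxter_slicingsE: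
  assumes "(P, B) \<in> baxter_slicings n"
  obtains u m d H V where "n = Suc (length m)" "P = poly u d" "above u m" "above m d"
    "slices m P B H V"
proof -
  obtain m H V where "n = Suc (length m)" "slices m P B H V"
    using assms by (auto simp: baxter_slicings_def baxter_slicing_iff_slices)
  then show thesis using slices_paths that by metis
qed

theorem theorem2:
  "(\<forall>n. \<forall>(P, B)\<in>baxter_slicings n. \<exists>!m. is_middle_path P B m) \<and>
   bij_betw slicing_paths (\<Union>n. baxter_slicings n) (\<Union>n. nilp_triples n) \<and>
   (\<forall>n. \<forall>S\<in>baxter_slicings n. slicing_paths S \<in> nilp_triples n)"
proof (intro conjI)
  show "\<forall>n. \<forall>(P, B)\<in>baxter_slicings n. \<exists>!m. is_middle_path P B m"
    by (auto elim!: baxter_slicingsE simp: is_middle_path_iff)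
  show size: "\<forall>n. \<forall>S\<in>baxter_slicings n. slicing_paths S \<in> nilp_triples n"
  proof (intro allI ballI)
    fix n S
    assume "S \<in> baxter_slicings n"
    then obtain P B where S: "S = (P, B)" "(P, B) \<in> baxter_slicings n" by (cases S) auto
    obtain u m d H V where *: "n = Suc (length m)" "P = poly u d" "above u m" "above m d"
      "slices m P B H V"
      using S(2) by (rule baxter_slicingsE)
    then have "slicing_paths S = (u, m, d)"
      unfolding S(1) *(2) by (intro slicing_paths_eq) auto
    then show "slicing_paths S \<in> nilp_triples n" using * by (simp add: nilp_triples_iff)
  qed
  have inj: "S = S'"
    if S: "S \<in> baxter_slicings n" "S' \<in> baxter_slicings n'" and eq: "slicing_paths S = slicing_paths S'"
    for S S' n n'
  proof -
    obtain P B P' B' where SS: "S = (P, B)" "S' = (P', B')" by (cases S; cases S') auto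
    obtain u m d H V where 1: "P = poly u d" "above u m" "above m d" "slices m P B H V"
      using S SS by (auto elim: baxter_slicingsE)
    obtain u' m' d' H' V' where 2: "P' = poly u' d'" "above u' m'" "above m' d'" "slices m' P' B' H' V'"
      using S SS by (auto elim: baxter_slicingsE)
    have "slicing_paths (P, B) = (u, m, d)" "slicing_paths (P', B') = (u', m', d')"
      unfolding 1(1) 2(1) using 1 2 by (auto intro: slicing_paths_eq)
    \<comment> \<open>The borders in the triple determine the polyomino, and the word
      \<open>m\<close> then determines its blocks.\<close>
    then have same: "P = P'" "m = m'" using eq 1(1) 2(1) SS by simp_all
    have "B = B'" using slices_unique[OF 1(4), of m' B'] 2(4) same by blast
    then show ?thesis using same SS by simp
  qed
  have "T \<in> slicing_paths ` (\<Union>n. baxter_slicings n)" if T: "T \<in> nilp_triples n" for T n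
  proof -
    obtain u m d where "T = (u, m, d)" by (cases T)
    then have *: "T = (u, m, d)" "above u m" "above m d" using T by (auto simp: nilp_triples_iff)
    then obtain B H V where s: "slices m (poly u d) B H V" using slices_exists by blast
    then have "(poly u d, B) \<in> (\<Union>n. baxter_slicings n)"
      by (auto simp: baxter_slicings_def baxter_slicing_iff_slices)
    moreover have "T = slicing_paths (poly u d, B)"
      using slicing_paths_eq[OF s *(2,3)] *(1) by simp
    ultimately show ?thesis by blast
  qed
  then have "slicing_paths ` (\<Union>n. baxter_slicings n) = (\<Union>n. nilp_triples n)"
    using size by auto
  moreover have "inj_on slicing_paths (\<Union>n. baxter_slicings n)"
    by (rule inj_onI) (elim UN_E, rule inj)
  ultimately show "bij_betw slicing_paths (\<Union>n. baxter_slicings n) (\<Union>n. nilp_triples n)"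
    by (simp add: bij_betw_def)
qed

end
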